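(* Let $n\ge 1$ and let $\sigma=(n_1^{m_1},n_2^{m_2},\dots,n_k^{m_k})$, with $n_1>n_2>\cdots>n_k>0$ and all $m_j\ge 1$, be a partition of $n$. Then $\delta(\sigma)=\delta^{\ast}(\sigma)=0$ if and only if there exist integers $s\ge 0$ and $t_2,\dots,t_k\ge 1$ such that $$\sigma=\bigl(n_1^{\,n_1+2s},\,n_2^{\,2t_2},\dots,n_k^{\,2t_k}\bigr),$$ i.e. $m_1=n_1+2s$ and $m_j=2t_j$ for $2\le j\le k$.
   Context: For a positive integer $n$, let $P_l(n)$ be the set of partitions of $n$ with exactly $l$ parts, i.e. tuples $(N_1,\dots,N_l)$ of positive integers with $N_1\ge\cdots\ge N_l>0$ and $\sum_j N_j=n$, and let $CP_l(n)=\bigoplus_{\sigma\in P_l(n)}\mathbb{R}\sigma$ be the real vector space with basis $P_l(n)$ (so $CP_l(n)=0$ if $l\le 0$). A partition is written in block form $\sigma=(n_1^{m_1},\dots,n_k^{m_k})$ with $n_1>\cdots>n_k>0$ and $m_j\ge1$, meaning that the part $n_j$ occurs $m_j$ times; thus $n=\sum_j n_jm_j$ and $l=\sum_j m_j$. In formulas below for the values of $\delta,\delta^{\ast}$, adjacent blocks with the same part size are merged by adding multiplicities, and blocks with multiplicity $0$ are omitted. The linear map $\delta:CP_l(n)\to CP_{l+1}(n)$ is determined on a basis element $\sigma=(n_1^{m_1},\dots,n_k^{m_k})$ by: (i) If $m_1>n_1-1$, then $\delta(\sigma)=0$. (ii) If $m_1\le n_1-1$ and there is $j$ with $2\le j\le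 k$ and $m_1=n_j$: if $m_j,m_{j+1},\dots,m_k$ are all even, then $\delta(\sigma)=((n_1-1)^{m_1},n_2^{m_2},\dots,n_j^{m_j+1},n_{j+1}^{m_{j+1}},\dots,n_k^{m_k})$; if some of $m_j,\dots,m_k$ is odd, then $\delta(\sigma)=0$. (iii) Otherwise there is a unique $i$ with $1\le i\le k$ and $n_i>m_1>n_{i+1}$ (where for $i=k$ the condition is just $n_k>m_1$). If $i=k$ or $m_{i+1},\dots,m_k$ are all even, then $\delta(\sigma)=((n_1-1)^{m_1},n_2^{m_2},\dots,n_i^{m_i},m_1^{1},n_{i+1}^{m_{i+1}},\dots,n_k^{m_k})$ (for $i=1$: $((n_1-1)^{m_1},m_1^{1},n_2^{m_2},\dots,n_k^{m_k})$); if some of $m_{i+1},\dots,m_k$ is odd, then $\delta(\sigma)=0$. The linear map $\delta^{\ast}:CP_l(n)\to CP_{l-1}(n)$ is determined on a basis element $\sigma=(n_1^{m_1},\dots,n_k^{m_k})$ as follows. If some $m_j$ is odd, let $t$ be the largest index $j$ with $m_j$ odd. (i) If $t=1$ or all $m_1,\dots,m_k$ are even: (a) if $n_1>m_1$ or $m_1=n_1+2i$ for some integer $i\ge0$, then $\delta^{\ast}(\sigma)=0$; (b) if $m_1=n_1+2i+1$ for some integer $i\ge 0$, then $\delta^{\ast}(\sigma)=((n_1+1)^{n_1},n_1^{2i},n_2^{m_2},\dots,n_k^{m_k})$. (ii) If $t\ge2$: (a) if $n_t>m_1$, then $\delta^{\ast}(\sigma)=0$; (b) if $n_t\le m_1$,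 then $\delta^{\ast}(\sigma)=((n_1+1)^{n_t},n_1^{m_1-n_t},n_2^{m_2},\dots,n_{t-1}^{m_{t-1}},n_t^{m_t-1},n_{t+1}^{m_{t+1}},\dots,n_k^{m_k})$. *)

theory Defs
  imports "HOL-Analysis.Finite_Function_Topology"
begin

definition partitions :: "nat \<Rightarrow> nat \<Rightarrow> nat list set" where
  "partitions l n =
     {\<sigma>. length \<sigma> = l \<and> sorted_wrt (\<ge>) \<sigma> \<and> (\<forall>x\<in>set \<sigma>. x > 0) \<and> sum_list \<sigma> = n}"

definition CP :: "nat \<Rightarrow> nat \<Rightarrow> (nat list \<Rightarrow>\<^sub>0 real) set" where
  "CP l n = {v. Poly_Mapping.keys v \<subseteq> partitions l n}"

abbreviation basis :: "nat list \<Rightarrow> (nat list \<Rightarrow>\<^sub>0 real)" where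
  "basis \<sigma> \<equiv> Poly_Mapping.single \<sigma> 1"

text \<open>A list of blocks (part, multiplicity) is expanded to the tuple of parts it stands for.
  Adjacent blocks with equal part size then merge and blocks of multiplicity 0 disappear,
  so the block lists produced by the formulas below need no normalisation.\<close>

definition of_blocks :: "(nat \<times> nat) list \<Rightarrow> nat list" where
  "of_blocks bs = concat (map (\<lambda>(a, m). replicate m a) bs)"

definition to_blocks :: "nat list \<Rightarrow> (nat \<times> nat) list" where
  "to_blocks \<sigma> = map (\<lambda>a. (a, count_list \<sigma> a)) (remdups \<sigma>)"

text \<open>Blocks are numbered from 1.\<close>

definition part :: "(nat \<times> nat) list \<Rightarrow> nat \<Rightarrow> nat" where
  "part bs j = fst (bs ! (j - 1))"

definition mult :: "(nat \<times> nat) list \<Rightarrow> nat \<Rightarrow> nat" where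
  "mult bs j = snd (bs ! (j - 1))"

definition segment :: "(nat \<times> nat) list \<Rightarrow> nat \<Rightarrow> nat \<Rightarrow> (nat \<times> nat) list" where
  "segment bs a b = map (\<lambda>j. (part bs j, mult bs j)) [a..<Suc b]"

text \<open>The values of the two maps on the basis vector of a partition with block form \<open>bs\<close>.
  For partitions of \<open>n \<ge> 1\<close> the values of \<open>THE\<close> and \<open>GREATEST\<close> only matter where a
  witness exists, and no subtraction is truncated.\<close>

definition delta_blocks :: "(nat \<times> nat) list \<Rightarrow> (nat list \<Rightarrow>\<^sub>0 real)" where
  "delta_blocks bs =
    (let k = length bs; p = part bs; m = mult bs in
     if m 1 > p 1 - 1 then 0
     else if \<exists>j\<in>{2..k}. m 1 = p j then
       (let j = (THE j. j \<in> {2..k} \<and> m 1 = p j) in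
        if \<forall>r\<in>{j..k}. even (m r)
        then basis (of_blocks ((p 1 - 1, m 1) # segment bs 2 (j - 1)
                                @ (p j, m j + 1) # segment bs (j + 1) k))
        else 0)
     else
       (let i = (THE i. i \<in> {1..k} \<and> p i > m 1 \<and> (i = k \<or> m 1 > p (i + 1))) in
        if i = k \<or> (\<forall>r\<in>{i + 1..k}. even (m r))
        then basis (of_blocks ((p 1 - 1, m 1) # segment bs 2 i
                                @ (m 1, 1) # segment bs (i + 1) k))
        else 0))"

definition delta_star_blocks :: "(nat \<times> nat) list \<Rightarrow> (nat list \<Rightarrow>\<^sub>0 real)" where
  "delta_star_blocks bs =
    (let k = length bs; p = part bs; m = mult bs;
         t = (GREATEST j. j \<in> {1..k} \<and> odd (m j)) in
     if (\<forall>j\<in>{1..k}. even (m j)) \<or> t = 1 then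
       (if p 1 > m 1 \<or> (\<exists>i. m 1 = p 1 + 2 * i) then 0
        else
          (let i = (THE i. m 1 = p 1 + 2 * i + 1) in
           basis (of_blocks ((p 1 + 1, p 1) # (p 1, 2 * i) # segment bs 2 k))))
     else
       (if p t > m 1 then 0
        else basis (of_blocks ((p 1 + 1, p t) # (p 1, m 1 - p t) # segment bs 2 (t - 1)
                                @ (p t, m t - 1) # segment bs (t + 1) k))))"

definition linear_extension :: "('a \<Rightarrow> 'b) \<Rightarrow> ('a \<Rightarrow>\<^sub>0 real) \<Rightarrow> 'b::real_vector" where
  "linear_extension f v = (\<Sum>x\<in>Poly_Mapping.keys v. Poly_Mapping.lookup v x *\<^sub>R f x)"

text \<open>Both maps are defined for all \<open>l\<close> and \<open>n\<close> at once, on the space of all finitely supported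
  combinations of lists; only their restrictions to the subspaces \<open>CP l n\<close> with \<open>n \<ge> 1\<close>
  are meaningful (\<open>delta_in_CP\<close> and \<open>delta_star_in_CP\<close> below).\<close>

definition delta :: "(nat list \<Rightarrow>\<^sub>0 real) \<Rightarrow> (nat list \<Rightarrow>\<^sub>0 real)" where
  "delta = linear_extension (\<lambda>\<sigma>. delta_blocks (to_blocks \<sigma>))"

definition delta_star :: "(nat list \<Rightarrow>\<^sub>0 real) \<Rightarrow> (nat list \<Rightarrow>\<^sub>0 real)" where
  "delta_star = linear_extension (\<lambda>\<sigma>. delta_star_blocks (to_blocks \<sigma>))"

lemma linear_extension_superset:
  assumes "finite S" "Poly_Mapping.keys v \<subseteq> S"
  shows "linear_extension f v = (\<Sum>x\<in>S. Poly_Mapping.lookup v x *\<^sub>R f x)"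
  unfolding linear_extension_def
  by (rule sum.mono_neutral_left) (use assms in \<open>auto simp: in_keys_iff\<close>)

lemma linear_linear_extension: "linear (linear_extension f)"
proof (rule linearI)
  fix v w :: "'a \<Rightarrow>\<^sub>0 real"
  let ?S = "Poly_Mapping.keys v \<union> Poly_Mapping.keys w"
  have 1: "linear_extension f u = (\<Sum>x\<in>?S. Poly_Mapping.lookup u x *\<^sub>R f x)"
    if "Poly_Mapping.keys u \<subseteq> ?S" for u
    using that by (intro linear_extension_superset) auto
  show "linear_extension f (v + w) = linear_extension f v + linear_extension f w"
    by (simp add: 1 Poly_Mapping.keys_add lookup_add scaleR_add_left sum.distrib)
next
  fix c :: real and v :: "'a \<Rightarrow>\<^sub>0 real"
  have lookup: "Poly_Mapping.lookup (c *\<^sub>R v) x = c * Poly_Mapping.lookup v x" for x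
    by (simp add: scaleR_poly_mapping_def)
  have "Poly_Mapping.keys (c *\<^sub>R v) \<subseteq> Poly_Mapping.keys v"
    by (auto simp: in_keys_iff lookup)
  then have "linear_extension f (c *\<^sub>R v)
      = (\<Sum>x\<in>Poly_Mapping.keys v. Poly_Mapping.lookup (c *\<^sub>R v) x *\<^sub>R f x)"
    by (intro linear_extension_superset) auto
  then show "linear_extension f (c *\<^sub>R v) = c *\<^sub>R linear_extension f v"
    by (simp add: linear_extension_def scaleR_sum_right lookup)
qed

lemma linear_extension_basis [simp]: "linear_extension f (basis \<sigma>) = f \<sigma>"
  by (simp add: linear_extension_def)

lemma linear_delta: "linear delta"
  unfolding delta_def by (rule linear_linear_extension)

lemma linear_delta_star: "linear delta_star"
  unfolding delta_star_def by (rule linear_linear_extension)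

lemma delta_basis: "delta (basis \<sigma>) = delta_blocks (to_blocks \<sigma>)"
  by (simp add: delta_def)

lemma delta_star_basis: "delta_star (basis \<sigma>) = delta_star_blocks (to_blocks \<sigma>)"
  by (simp add: delta_star_def)


definition block_list :: "(nat \<times> nat) list \<Rightarrow> bool" where
  "block_list bs \<longleftrightarrow> sorted_wrt (>) (map fst bs) \<and> (\<forall>(a, m)\<in>set bs. a > 0 \<and> m > 0)"

lemma of_blocks_Nil [simp]: "of_blocks [] = []"
  and of_blocks_Cons [simp]: "of_blocks ((a, m) # bs) = replicate m a @ of_blocks bs"
  and of_blocks_append [simp]: "of_blocks (bs @ cs) = of_blocks bs @ of_blocks cs"
  by (auto simp: of_blocks_def)

lemma set_of_blocks: "set (of_blocks bs) \<subseteq> fst ` set bs"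
  by (induction bs) auto

lemma to_blocks_of_blocks:
  assumes "block_list bs"
  shows "to_blocks (of_blocks bs) = bs"
  using assms
proof (induction bs)
  case Nil
  then show ?case by (simp add: to_blocks_def)
next
  case (Cons b bs)
  obtain a m where b: "b = (a, m)" by (cases b)
  have IH: "to_blocks (of_blocks bs) = bs"
    using Cons by (auto simp: block_list_def)
  have m: "m > 0" and lt: "\<forall>x\<in>set (of_blocks bs). x < a"
    using Cons.prems set_of_blocks[of bs] by (auto simp: block_list_def b)
  have notin: "a \<notin> set (of_blocks bs)" using lt by auto
  have rem: "remdups (replicate (Suc r) a @ of_blocks bs) = a # remdups (of_blocks bs)" for r
    using notin by (induction r) auto
  have cnt0: "count_list (replicate m a) x = (if x = a then m else 0)" for x
    by (induction m) auto
  have cnt: "count_list (replicate m a @ of_blocks bs) x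
      = (if x = a then m else count_list (of_blocks bs) x)" for x
    using notin by (simp add: cnt0)
  have "to_blocks (replicate m a @ of_blocks bs) = (a, m) # to_blocks (of_blocks bs)"
    using m notin rem[of "m - 1"] unfolding to_blocks_def by (auto simp: cnt cnt0)
  then show ?case using IH by (simp add: b)
qed

lemma ex_block_list:
  assumes "sorted_wrt (\<ge>) \<sigma>" "\<forall>x\<in>set \<sigma>. x > 0"
  shows "\<exists>bs. block_list bs \<and> of_blocks bs = \<sigma> \<and> fst ` set bs \<subseteq> set \<sigma>"
  using assms
proof (induction \<sigma>)
  case Nil
  then show ?case by (intro exI[of _ "[]"]) (auto simp: block_list_def)
next
  case (Cons x \<sigma>)
  then obtain bs where bs: "block_list bs" "of_blocks bs = \<sigma>" "fst ` set bs \<subseteq> set \<sigma>"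
    by auto
  show ?case
  proof (cases "\<exists>m cs. bs = (x, m) # cs")
    case True
    then obtain m cs where "bs = (x, m) # cs" by auto
    with bs show ?thesis
      by (intro exI[of _ "(x, Suc m) # cs"]) (auto simp: block_list_def)
  next
    case False
    have "\<forall>y\<in>fst ` set bs. y < x"
    proof (cases bs)
      case (Cons c cs)
      then have "fst c \<noteq> x" "fst c \<le> x"
        using False bs Cons.prems by (cases c; auto)+
      then show ?thesis using Cons bs(1) by (auto simp: block_list_def)
    qed auto
    with bs Cons.prems show ?thesis
      by (intro exI[of _ "(x, 1) # bs"]) (auto simp: block_list_def)
  qed
qed

lemma of_blocks_to_blocks:
  assumes "\<sigma> \<in> partitions l n"
  shows "block_list (to_blocks \<sigma>)" "of_blocks (to_blocks \<sigma>) = \<sigma>"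
  using ex_block_list[of \<sigma>] assms to_blocks_of_blocks by (auto simp: partitions_def)

lemma length_of_blocks: "length (of_blocks bs) = (\<Sum>(a, m)\<leftarrow>bs. m)"
  by (induction bs) auto

lemma sum_list_of_blocks: "sum_list (of_blocks bs) = (\<Sum>(a, m)\<leftarrow>bs. a * m)"
  by (induction bs) (auto simp: sum_list_replicate)

lemma sorted_wrt_replicate_ge: "sorted_wrt (\<ge>) (replicate m (a::nat))"
  by (induction m) auto

lemma of_blocks_in_partitions:
  assumes "sorted_wrt (\<ge>) (map fst bs)" "\<forall>a\<in>fst ` set bs. a > 0"
    and "(\<Sum>(a, m)\<leftarrow>bs. m) = l" "(\<Sum>(a, m)\<leftarrow>bs. a * m) = n"
  shows "of_blocks bs \<in> partitions l n"
proof -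
  have "sorted_wrt (\<ge>) (of_blocks bs)"
    using assms(1)
  proof (induction bs)
    case (Cons b bs)
    then show ?case
      using set_of_blocks[of bs]
      by (cases b) (fastforce simp: sorted_wrt_append sorted_wrt_replicate_ge)
  qed simp
  then show ?thesis
    using assms set_of_blocks[of bs]
    by (auto simp: partitions_def length_of_blocks sum_list_of_blocks)
qed

lemma zero_in_CP [simp]: "0 \<in> CP l n"
  by (simp add: CP_def)

lemma basis_in_CP [simp]: "basis \<sigma> \<in> CP l n \<longleftrightarrow> \<sigma> \<in> partitions l n"
  by (simp add: CP_def)

lemma linear_extension_in_CP:
  assumes "\<And>\<sigma>. \<sigma> \<in> partitions l n \<Longrightarrow> f \<sigma> \<in> CP l' n" "v \<in> CP l n"
  shows "linear_extension f v \<in> CP l' n"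
proof -
  have add: "u + w \<in> CP l' n" if "u \<in> CP l' n" "w \<in> CP l' n" for u w
    using that Poly_Mapping.keys_add[of u w] by (auto simp: CP_def)
  have scale: "c *\<^sub>R w \<in> CP l' n" if "w \<in> CP l' n" for c w
    using that by (auto simp: CP_def in_keys_iff scaleR_poly_mapping_def)
  have "(\<Sum>x\<in>S. Poly_Mapping.lookup v x *\<^sub>R f x) \<in> CP l' n"
    if "finite S" "S \<subseteq> partitions l n" for S
    using that by (induction S) (auto intro!: add scale assms(1))
  then show ?thesis
    using assms(2) unfolding linear_extension_def by (simp add: CP_def)
qed

context
  fixes bs :: "(nat \<times> nat) list" and k :: nat
  assumes bs: "block_list bs" and k: "k = length bs" "k \<ge> 1"
begin

lemma segment_all: "segment bs 1 k = bs"
  using k by (intro nth_equalityI) (auto simp: segment_def part_def mult_def simp del: upt_Suc)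

lemma segment_split:
  assumes "1 \<le> a" "a \<le> Suc b" "b \<le> c"
  shows "segment bs a c = segment bs a b @ segment bs (b + 1) c"
proof -
  have "[a..<Suc c] = [a..<Suc b] @ [Suc b..<Suc c]"
    using assms upt_add_eq_append[of a "Suc b" "c - b"] by simp
  then show ?thesis by (simp add: segment_def)
qed

lemma segment_single: "segment bs a a = [(part bs a, mult bs a)]"
  by (simp add: segment_def)

lemma segment_first: "bs = (part bs 1, mult bs 1) # segment bs 2 k"
  using segment_split[of 1 1 k] segment_all k by (simp add: segment_single numeral_2_eq_2)

lemma segment_at:
  assumes "2 \<le> j" "j \<le> k"
  shows "segment bs 2 k = segment bs 2 (j - 1) @ (part bs j, mult bs j) # segment bs (j + 1) k"
  using segment_split[of 2 "j - 1" k] segment_split[of j j k] assms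
  by (simp add: segment_single)

lemma part_decreasing:
  assumes "1 \<le> i" "i < j" "j \<le> k"
  shows "part bs j < part bs i"
  using bs sorted_wrt_nth_less[of "(>)" "map fst bs" "i - 1" "j - 1"] assms k
  by (auto simp: block_list_def part_def)

lemma part_decreasing_le:
  assumes "1 \<le> i" "i \<le> j" "j \<le> k"
  shows "part bs j \<le> part bs i"
  using part_decreasing[of i j] assms by (cases "i = j") auto

lemma part_mult_pos:
  assumes "1 \<le> j" "j \<le> k"
  shows "part bs j > 0" "mult bs j > 0"
  using bs assms k nth_mem[of "j - 1" bs]
  by (auto simp: block_list_def part_def mult_def case_prod_beta)

lemma sorted_segment:
  assumes "1 \<le> a" "b \<le> k"
  shows "sorted_wrt (\<ge>) (map fst (segment bs a b))"
  using assms
  by (auto simp: segment_def sorted_wrt_map comp_def simp del: upt_Suc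
      intro!: sorted_wrt_mono_rel[OF _ sorted_wrt_upt] part_decreasing_le)

lemma set_segment: "set (segment bs a b) = (\<lambda>j. (part bs j, mult bs j)) ` {a..b}"
  by (auto simp: segment_def)

lemma split_sums:
  assumes "of_blocks bs \<in> partitions l n"
  shows "l = mult bs 1 + (\<Sum>(a, m)\<leftarrow>segment bs 2 k. m)"
    and "n = part bs 1 * mult bs 1 + (\<Sum>(a, m)\<leftarrow>segment bs 2 k. a * m)"
proof -
  have "l = (\<Sum>(a, m)\<leftarrow>bs. m)" "n = (\<Sum>(a, m)\<leftarrow>bs. a * m)"
    using assms by (auto simp: partitions_def length_of_blocks sum_list_of_blocks)
  then show "l = mult bs 1 + (\<Sum>(a, m)\<leftarrow>segment bs 2 k. m)"
    and "n = part bs 1 * mult bs 1 + (\<Sum>(a, m)\<leftarrow>segment bs 2 k. a * m)"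
    using arg_cong[OF segment_first, of "\<lambda>cs. \<Sum>(a, m)\<leftarrow>cs. m"]
      arg_cong[OF segment_first, of "\<lambda>cs. \<Sum>(a, m)\<leftarrow>cs. a * m"]
    by simp_all
qed

lemma delta_blocks_in_CP:
  assumes "of_blocks bs \<in> partitions l n"
  shows "delta_blocks bs \<in> CP (l + 1) n"
proof -
  let ?p = "part bs" and ?m = "mult bs"
  note sums = split_sums[OF assms]
  show ?thesis
  proof (cases "?m 1 > ?p 1 - 1")
    case True
    then show ?thesis by (simp add: delta_blocks_def Let_def)
  next
    case m1: False
    have m1pos: "?m 1 > 0" "?p 1 > 0" using part_mult_pos[of 1] k by auto
    have p1: "?p 1 - 1 > 0" using m1 m1pos by simp
    from m1pos obtain q where q: "?p 1 = Suc q" by (cases "?p 1") auto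
    have qle: "?p r \<le> q" if "2 \<le> r" "r \<le> k" for r
      using part_decreasing[of 1 r] that q by simp
    show ?thesis
    proof (cases "\<exists>j\<in>{2..k}. ?m 1 = ?p j")
      case ex: True
      then obtain j where j: "2 \<le> j" "j \<le> k" "?m 1 = ?p j" by auto
      have the_j: "(THE j. j \<in> {2..k} \<and> ?m 1 = ?p j) = j"
      proof (rule the_equality)
        fix i assume i: "i \<in> {2..k} \<and> ?m 1 = ?p i"
        then show "i = j"
          using part_decreasing[of i j] part_decreasing[of j i] j
          by (cases i j rule: linorder_cases) auto
      qed (use j in auto)
      let ?bs = "(?p 1 - 1, ?m 1) # segment bs 2 (j - 1)
                  @ (?p j, ?m j + 1) # segment bs (j + 1) k"
      have "of_blocks ?bs \<in> partitions (l + 1) n"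
      proof (rule of_blocks_in_partitions)
        show "sorted_wrt (\<ge>) (map fst ?bs)"
          using j sorted_segment[of 2 "j - 1"] sorted_segment[of "j + 1" k] qle q
          by (auto simp: sorted_wrt_append set_segment intro!: part_decreasing_le)
        show "\<forall>a\<in>fst ` set ?bs. a > 0"
          using j p1 part_mult_pos by (auto simp: set_segment)
        show "(\<Sum>(a, m)\<leftarrow>?bs. m) = l + 1"
          using sums(1) segment_at[OF j(1,2)] by simp
        show "(\<Sum>(a, m)\<leftarrow>?bs. a * m) = n"
          using sums(2) segment_at[OF j(1,2)] q j(3) by (simp add: algebra_simps)
      qed
      then show ?thesis
        using m1 ex unfolding delta_blocks_def Let_def k(1)[symmetric] the_j by simp
    next
      case nex: False
      let ?S = "{i \<in> {1..k}. ?p i > ?m 1}"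
      define i where "i = Max ?S"
      have "1 \<in> ?S" using m1 q k by simp
      then have iS: "i \<in> ?S" unfolding i_def by (intro Max_in) auto
      have max: "r \<le> i" if "r \<in> ?S" for r
        unfolding i_def using that by (intro Max_ge) auto
      have below: "?p r < ?m 1" if "i < r" "r \<le> k" for r
        using max[of r] nex that iS by (force simp: not_less order.order_iff_strict)
      have the_i: "(THE i. i \<in> {1..k} \<and> ?p i > ?m 1 \<and> (i = k \<or> ?m 1 > ?p (i + 1))) = i"
      proof (rule the_equality)
        show "i \<in> {1..k} \<and> ?p i > ?m 1 \<and> (i = k \<or> ?m 1 > ?p (i + 1))"
          using iS below[of "i + 1"] by (cases "i = k") auto
        fix r assume r: "r \<in> {1..k} \<and> ?p r > ?m 1 \<and> (r = k \<or> ?m 1 > ?p (r + 1))"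
        then have "r \<le> i" using max by auto
        moreover have "\<not> r < i"
        proof
          assume "r < i"
          then have "?p i \<le> ?p (r + 1)" "r \<noteq> k"
            using iS part_decreasing_le[of "r + 1" i] by auto
          then show False using r iS by auto
        qed
        ultimately show "r = i" by simp
      qed
      let ?bs = "(?p 1 - 1, ?m 1) # segment bs 2 i @ (?m 1, 1) # segment bs (i + 1) k"
      have seg: "segment bs 2 k = segment bs 2 i @ segment bs (i + 1) k"
        using iS segment_split[of 2 i k] by simp
      have "of_blocks ?bs \<in> partitions (l + 1) n"
      proof (rule of_blocks_in_partitions)
        have "?m 1 \<le> ?p r" if "2 \<le> r" "r \<le> i" for r
          using part_decreasing_le[of r i] iS that by force
        moreover have "?p r \<le> ?m 1" if "Suc i \<le> r" "r \<le> k" for r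
          using below[of r] that by simp
        ultimately show "sorted_wrt (\<ge>) (map fst ?bs)"
          using iS m1 sorted_segment[of 2 i] sorted_segment[of "i + 1" k] qle q
          by (auto simp: sorted_wrt_append set_segment intro!: part_decreasing_le)
        show "\<forall>a\<in>fst ` set ?bs. a > 0"
          using iS m1pos p1 part_mult_pos by (auto simp: set_segment)
        show "(\<Sum>(a, m)\<leftarrow>?bs. m) = l + 1"
          using sums(1) seg by simp
        show "(\<Sum>(a, m)\<leftarrow>?bs. a * m) = n"
          using sums(2) seg q by (simp add: algebra_simps)
      qed
      then show ?thesis
        using m1 nex unfolding delta_blocks_def Let_def k(1)[symmetric] the_i by simp
    qed
  qed
qed

lemma delta_star_blocks_in_CP:
  assumes "of_blocks bs \<in> partitions l n"
  shows "delta_star_blocks bs \<in> CP (l - 1) n"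
proof -
  let ?p = "part bs" and ?m = "mult bs"
  note sums = split_sums[OF assms]
  define t where "t = (GREATEST j. j \<in> {1..k} \<and> odd (?m j))"
  note eq = delta_star_blocks_def Let_def k(1)[symmetric] t_def[symmetric]
  have pos: "?p 1 > 0" using part_mult_pos[of 1] k by auto
  show ?thesis
  proof (cases "(\<forall>j\<in>{1..k}. even (?m j)) \<or> t = 1")
    case c: True
    show ?thesis
    proof (cases "?p 1 > ?m 1 \<or> (\<exists>i. ?m 1 = ?p 1 + 2 * i)")
      case True
      with c show ?thesis
        unfolding eq by simp
    next
      case d: False
      have "odd (?m 1 - ?p 1)"
      proof
        assume "even (?m 1 - ?p 1)"
        then obtain i where "?m 1 - ?p 1 = 2 * i"
          using evenE by blast
        then have "?m 1 = ?p 1 + 2 * i" using d by (metis le_add_diff_inverse not_less)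
        then show False using d by blast
      qed
      then obtain i where "?m 1 - ?p 1 = 2 * i + 1" using oddE by blast
      then have i: "?m 1 = ?p 1 + 2 * i + 1" using d by auto
      then have the_i: "(THE i. ?m 1 = ?p 1 + 2 * i + 1) = i"
        by (intro the_equality) auto
      let ?bs = "(?p 1 + 1, ?p 1) # (?p 1, 2 * i) # segment bs 2 k"
      have le: "?p r \<le> ?p 1" if "2 \<le> r" "r \<le> k" for r
        using part_decreasing_le[of 1 r] that by simp
      have "of_blocks ?bs \<in> partitions (l - 1) n"
      proof (rule of_blocks_in_partitions)
        show "sorted_wrt (\<ge>) (map fst ?bs)"
          using sorted_segment[of 2 k] le by (auto simp: set_segment intro: le_SucI)
        show "\<forall>a\<in>fst ` set ?bs. a > 0"
          using pos part_mult_pos by (auto simp: set_segment)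
        show "(\<Sum>(a, m)\<leftarrow>?bs. m) = l - 1"
          using sums(1) i by simp
        show "(\<Sum>(a, m)\<leftarrow>?bs. a * m) = n"
          using sums(2) i by (simp add: algebra_simps)
      qed
      then show ?thesis
        using c d unfolding eq the_i by simp
    qed
  next
    case c: False
    then obtain j where "j \<in> {1..k} \<and> odd (?m j)" by auto
    then have "t \<in> {1..k} \<and> odd (?m t)"
      unfolding t_def by (rule GreatestI_nat[where b = k]) auto
    then have t: "2 \<le> t" "t \<le> k" "odd (?m t)" using c by auto
    show ?thesis
    proof (cases "?p t > ?m 1")
      case True
      with c show ?thesis
        unfolding eq by auto
    next
      case d: False
      let ?bs = "(?p 1 + 1, ?p t) # (?p 1, ?m 1 - ?p t) # segment bs 2 (t - 1)
                  @ (?p t, ?m t - 1) # segment bs (t + 1) k"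
      obtain e where e: "?m 1 = ?p t + e" using d by (metis le_Suc_ex not_less)
      obtain f where f: "?m t = Suc f" using t(3) by (cases "?m t") auto
      have le: "?p r \<le> ?p 1" if "2 \<le> r" "r \<le> k" for r
        using part_decreasing_le[of 1 r] that by simp
      have le': "?p r \<le> Suc (?p 1)" if "2 \<le> r" "r \<le> t - 1" for r
        using le[of r] that t by linarith
      have "of_blocks ?bs \<in> partitions (l - 1) n"
      proof (rule of_blocks_in_partitions)
        show "sorted_wrt (\<ge>) (map fst ?bs)"
          using t sorted_segment[of 2 "t - 1"] sorted_segment[of "t + 1" k] le le'
          by (auto simp: sorted_wrt_append set_segment intro!: part_decreasing_le intro: le_SucI)
        show "\<forall>a\<in>fst ` set ?bs. a > 0"
          using t pos part_mult_pos by (auto simp: set_segment)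
        show "(\<Sum>(a, m)\<leftarrow>?bs. m) = l - 1"
          using sums(1) segment_at[OF t(1,2)] e f by simp
        show "(\<Sum>(a, m)\<leftarrow>?bs. a * m) = n"
          using sums(2) segment_at[OF t(1,2)] e f by (simp add: algebra_simps)
      qed
      then show ?thesis
        using c d unfolding eq by auto
    qed
  qed
qed

end

lemma to_blocks_nonempty:
  assumes "n \<ge> 1" "\<sigma> \<in> partitions l n"
  shows "length (to_blocks \<sigma>) \<ge> 1"
  using assms by (cases \<sigma>) (auto simp: partitions_def to_blocks_def Suc_le_eq)

lemma delta_in_CP:
  assumes "n \<ge> 1" "v \<in> CP l n"
  shows "delta v \<in> CP (l + 1) n"
  unfolding delta_def
  by (rule linear_extension_in_CP[OF _ assms(2)], rule delta_blocks_in_CP[OF _ refl])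
    (use assms of_blocks_to_blocks to_blocks_nonempty in auto)

lemma delta_star_in_CP:
  assumes "n \<ge> 1" "v \<in> CP l n"
  shows "delta_star v \<in> CP (l - 1) n"
  unfolding delta_star_def
  by (rule linear_extension_in_CP[OF _ assms(2)], rule delta_star_blocks_in_CP[OF _ refl])
    (use assms of_blocks_to_blocks to_blocks_nonempty in auto)

end

theory Submission
  imports Defs
begin

text \<open>Since the parts decrease, the block conditions in the two maps can be phrased by comparing
  parts with \<open>m\<^sub>1\<close>: \<open>\<delta>\<close> vanishes iff \<open>m\<^sub>1 \<ge> n\<^sub>1\<close> or some odd block \<open>r \<ge> 2\<close> has \<open>n\<^sub>r \<le> m\<^sub>1\<close>, and
  \<open>\<delta>\<^sup>*\<close> vanishes iff every odd block \<open>r \<ge> 2\<close> has \<open>n\<^sub>r > m\<^sub>1\<close> and, when there is no such block,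
  \<open>m\<^sub>1 < n\<^sub>1\<close> or \<open>m\<^sub>1 - n\<^sub>1\<close> is even and nonnegative. If both vanish then \<open>m\<^sub>1 \<ge> n\<^sub>1 > n\<^sub>r\<close>,
  so there are no odd blocks beyond the first.\<close>

lemma basis_neq_0: "basis \<sigma> \<noteq> 0"
  by (metis lookup_single_eq lookup_zero zero_neq_one)

text \<open>When m_1 < n_1, the cases m_1 = n_j and n_i > m_1 > n_{i+1} test the parity of the same
  blocks, namely those \<open>r\<close> in \<open>{2..k}\<close> with part at most m_1. If all of
  these are even, the value is a basis vector and so nonzero.\<close>

lemma delta_blocks_eq_0_iff:
  assumes bs: "block_list bs" and k: "k = length bs" "k \<ge> 1"
  shows "delta_blocks bs = 0 \<longleftrightarrow>
    part bs 1 \<le> mult bs 1 \<or> (\<exists>r\<in>{2..k}. part bs r \<le> mult bs 1 \<and> odd (mult bs r))"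
proof -
  let ?p = "part bs" and ?m = "mult bs"
  note dec = part_decreasing[OF bs k] and dec_le = part_decreasing_le[OF bs k]
  have pos: "?p 1 > 0" using part_mult_pos[OF bs k] k by auto
  show ?thesis
  proof (cases "?p 1 \<le> ?m 1")
    case True
    \<comment> \<open>\<open>pos\<close> ensures that the natural-number subtraction is not
      truncated.\<close>
    then have "?m 1 > ?p 1 - 1" using pos by linarith
    with True show ?thesis by (simp add: delta_blocks_def Let_def)
  next
    case m1: False
    have m1': "\<not> ?m 1 > ?p 1 - 1" using m1 by simp
    show ?thesis
    proof (cases "\<exists>j\<in>{2..k}. ?m 1 = ?p j")
      case ex: True
      then obtain j where j: "2 \<le> j" "j \<le> k" "?m 1 = ?p j" by auto
      have the_j: "(THE j. j \<in> {2..k} \<and> ?m 1 = ?p j) = j"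
      proof (rule the_equality)
        fix i assume i: "i \<in> {2..k} \<and> ?m 1 = ?p i"
        then show "i = j"
          using dec[of i j] dec[of j i] j
          by (cases i j rule: linorder_cases) auto
      qed (use j in auto)
      have "?p r \<le> ?m 1 \<longleftrightarrow> j \<le> r" if "r \<in> {2..k}" for r
        using dec[of r j] dec_le[of j r] j that by (cases "j \<le> r") auto
      then have "(\<forall>r\<in>{j..k}. even (?m r)) \<longleftrightarrow> \<not> (\<exists>r\<in>{2..k}. ?p r \<le> ?m 1 \<and> odd (?m r))"
        using j by fastforce
      then show ?thesis
        using m1 m1' ex unfolding delta_blocks_def Let_def k(1)[symmetric] the_j
        by (simp add: basis_neq_0)
    next
      case nex: False
      \<comment> \<open>The index that \<open>THE\<close> selects is the last block whose part
        exceeds m_1; block 1 is always such a block here.\<close>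
      let ?S = "{i \<in> {1..k}. ?p i > ?m 1}"
      define i where "i = Max ?S"
      have "1 \<in> ?S" using m1 k by simp
      then have iS: "i \<in> ?S" unfolding i_def by (intro Max_in) auto
      have max: "r \<le> i" if "r \<in> ?S" for r
        unfolding i_def using that by (intro Max_ge) auto
      have below: "?p r < ?m 1" if "i < r" "r \<le> k" for r
        using max[of r] nex that iS by (force simp: not_less order.order_iff_strict)
      have the_i: "(THE i. i \<in> {1..k} \<and> ?p i > ?m 1 \<and> (i = k \<or> ?m 1 > ?p (i + 1))) = i"
      proof (rule the_equality)
        show "i \<in> {1..k} \<and> ?p i > ?m 1 \<and> (i = k \<or> ?m 1 > ?p (i + 1))"
          using iS below[of "i + 1"] by (cases "i = k") auto
        fix r assume r: "r \<in> {1..k} \<and> ?p r > ?m 1 \<and> (r = k \<or> ?m 1 > ?p (r + 1))"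
        then have "r \<le> i" using max by auto
        moreover have "\<not> r < i"
        proof
          assume "r < i"
          then have "?p i \<le> ?p (r + 1)" "r \<noteq> k"
            using iS dec_le[of "r + 1" i] by auto
          then show False using r iS by auto
        qed
        ultimately show "r = i" by simp
      qed
      have "?p r \<le> ?m 1 \<longleftrightarrow> i + 1 \<le> r" if "r \<in> {2..k}" for r
        using dec_le[of r i] below[of r] iS that by (cases "i + 1 \<le> r") auto
      then have "i = k \<or> (\<forall>r\<in>{i + 1..k}. even (?m r))
          \<longleftrightarrow> \<not> (\<exists>r\<in>{2..k}. ?p r \<le> ?m 1 \<and> odd (?m r))"
        using iS by fastforce
      then show ?thesis
        using m1 m1' nex unfolding delta_blocks_def Let_def k(1)[symmetric] the_i
        by (simp add: basis_neq_0)
    qed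
  qed
qed

text \<open>The last odd block \<open>t\<close> has the smallest part among the odd blocks, so for
  \<open>t\<close> at least 2 the single test n_t > m_1 speaks for all odd blocks beyond the
  first.\<close>

lemma delta_star_blocks_eq_0_iff:
  assumes bs: "block_list bs" and k: "k = length bs" "k \<ge> 1"
  shows "delta_star_blocks bs = 0 \<longleftrightarrow>
    (\<forall>r\<in>{2..k}. odd (mult bs r) \<longrightarrow> mult bs 1 < part bs r) \<and>
    ((\<forall>r\<in>{2..k}. even (mult bs r)) \<longrightarrow>
      mult bs 1 < part bs 1 \<or> (\<exists>i. mult bs 1 = part bs 1 + 2 * i))"
proof -
  let ?p = "part bs" and ?m = "mult bs"
  define t where "t = (GREATEST j. j \<in> {1..k} \<and> odd (?m j))"
  note eq = delta_star_blocks_def Let_def k(1)[symmetric] t_def[symmetric]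
  \<comment> \<open>\<open>GREATEST\<close> is only known to return an odd block when one exists, so
    this fact and the next assume a witness \<open>j\<close>.\<close>
  have t: "t \<in> {1..k} \<and> odd (?m t)" if "j \<in> {1..k}" "odd (?m j)" for j
    unfolding t_def by (rule GreatestI_nat[where b = k]) (use that in auto)
  have t_ge: "j \<le> t" if "j \<in> {1..k}" "odd (?m j)" for j
    unfolding t_def by (rule Greatest_le_nat[where b = k]) (use that in auto)
  show ?thesis
  proof (cases "(\<forall>j\<in>{1..k}. even (?m j)) \<or> t = 1")
    case True
    then have "\<forall>r\<in>{2..k}. even (?m r)"
    proof (elim disjE)
      assume "t = 1"
      show ?thesis
      proof
        fix r assume r: "r \<in> {2..k}"
        show "even (?m r)"
          using t_ge[of r] r \<open>t = 1\<close> by fastforce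
      qed
    qed auto
    with True show ?thesis
      unfolding eq by (simp add: basis_neq_0)
  next
    case False
    then obtain j where "j \<in> {1..k}" "odd (?m j)" by auto
    with t False have t2: "2 \<le> t" "t \<le> k" "odd (?m t)" by force+
    have "(\<forall>r\<in>{2..k}. odd (?m r) \<longrightarrow> ?m 1 < ?p r) \<longleftrightarrow> ?m 1 < ?p t"
    proof
      assume "?m 1 < ?p t"
      moreover have "?p t \<le> ?p r" if "r \<in> {2..k}" "odd (?m r)" for r
        using part_decreasing_le[OF bs k, of r t] t_ge[of r] t2 that by auto
      ultimately show "\<forall>r\<in>{2..k}. odd (?m r) \<longrightarrow> ?m 1 < ?p r"
        by (meson less_le_trans)
    qed (use t2 in auto)
    moreover have "\<not> (\<forall>r\<in>{2..k}. even (?m r))" using t2 by auto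
    moreover have "delta_star_blocks bs = 0 \<longleftrightarrow> ?m 1 < ?p t"
      using False unfolding eq by (simp only: if_False) (simp add: basis_neq_0)
    ultimately show ?thesis by blast
  qed
qed

lemma delta_and_delta_star_blocks_eq_0_iff:
  assumes bs: "block_list bs" and k: "k = length bs" "k \<ge> 1"
  shows "delta_blocks bs = 0 \<and> delta_star_blocks bs = 0 \<longleftrightarrow>
    (\<exists>s. mult bs 1 = part bs 1 + 2 * s) \<and> (\<forall>r\<in>{2..k}. even (mult bs r))"
proof -
  have less: "part bs r < part bs 1" if "r \<in> {2..k}" for r
    using part_decreasing[OF bs k, of 1 r] that by auto
  show ?thesis (is "?L \<longleftrightarrow> ?R")
  proof
    \<comment> \<open>The vanishing of \<open>delta_star_blocks\<close> excludes an odd later block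
      with part at most m_1, so \<open>delta_blocks\<close> can vanish only through n_1 \<le>
      m_1.\<close>
    assume L: ?L
    then have le: "part bs 1 \<le> mult bs 1"
      unfolding delta_blocks_eq_0_iff[OF assms] delta_star_blocks_eq_0_iff[OF assms]
      by (meson not_less)
    have "even (mult bs r)" if "r \<in> {2..k}" for r
      using L le less[OF that] that unfolding delta_star_blocks_eq_0_iff[OF assms] by force
    then show ?R
      using L le unfolding delta_star_blocks_eq_0_iff[OF assms] by (simp add: not_less)
  next
    assume ?R
    then show ?L
      unfolding delta_blocks_eq_0_iff[OF assms] delta_star_blocks_eq_0_iff[OF assms] by auto
  qed
qed

text \<open>\<open>to_blocks\<close> inverts \<open>of_blocks\<close> on block lists. This lets
  equality of partitions be read off from the multiplicities.\<close>

lemma of_blocks_eq_iff: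
  assumes "block_list bs" "block_list cs"
  shows "of_blocks bs = of_blocks cs \<longleftrightarrow> bs = cs"
  using assms to_blocks_of_blocks by metis

lemma block_list_map_upt:
  assumes "\<forall>i\<in>{a..b}. \<forall>j\<in>{a..b}. i < j \<longrightarrow> p i > p j"
    and "\<forall>j\<in>{a..b}. p j > 0" "\<forall>j\<in>{a..b}. m j > 0"
  shows "block_list (map (\<lambda>j. (p j, m j)) [a..<Suc b])"
  using assms
  by (auto simp: block_list_def sorted_wrt_map comp_def simp del: upt_Suc
      intro!: sorted_wrt_mono_rel[OF _ sorted_wrt_upt])

theorem proposition8:
  fixes n l k :: nat and p m :: "nat \<Rightarrow> nat" and \<sigma> :: "nat list"
  assumes "n \<ge> 1"
    and "\<sigma> \<in> partitions l n"
    and "\<forall>i\<in>{1..k}. \<forall>j\<in>{1..k}. i < j \<longrightarrow> p i > p j"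
    and "\<forall>j\<in>{1..k}. p j > 0"
    and "\<forall>j\<in>{1..k}. m j \<ge> 1"
    and "\<sigma> = of_blocks (map (\<lambda>j. (p j, m j)) [1..<Suc k])"
  shows "delta (basis \<sigma>) = 0 \<and> delta_star (basis \<sigma>) = 0 \<longleftrightarrow>
    (\<exists>s t. (\<forall>j\<in>{2..k}. t j \<ge> 1) \<and>
       \<sigma> = of_blocks ((p 1, p 1 + 2 * s) # map (\<lambda>j. (p j, 2 * t j)) [2..<Suc k]))"
proof -
  let ?bs = "map (\<lambda>j. (p j, m j)) [1..<Suc k]"
  let ?R = "\<lambda>s t. (p 1, p 1 + 2 * s) # map (\<lambda>j. (p j, 2 * t j)) [2..<Suc k]"
  have bs: "block_list ?bs"
    using assms(3-5) by (intro block_list_map_upt) auto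
  have k: "k \<ge> 1"
    using assms(1,2,6) by (cases k) (auto simp: partitions_def)
  have upt: "[1..<Suc k] = 1 # [2..<Suc k]"
    using k upt_conv_Cons[of 1 "Suc k"] by (simp add: numeral_2_eq_2 del: upt_Suc)
  have part: "part ?bs j = p j" and mult: "mult ?bs j = m j" if "j \<in> {1..k}" for j
    using that by (auto simp: part_def mult_def simp del: upt_Suc)
  have R: "block_list (?R s t)" if "\<forall>j\<in>{2..k}. t j \<ge> 1" for s t
  proof -
    \<comment> \<open>One multiplicity function for head and tail, so that
      \<open>block_list_map_upt\<close> applies to the whole list.\<close>
    let ?m = "\<lambda>j. if j = 1 then p 1 + 2 * s else 2 * t j"
    have "?R s t = map (\<lambda>j. (p j, ?m j)) [1..<Suc k]"
      unfolding upt by (auto simp del: upt_Suc)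
    moreover have "?m j > 0" if "j \<in> {1..k}" for j
    proof (cases "j = 1")
      case False
      then have "j \<in> {2..k}" using that by auto
      with \<open>\<forall>j\<in>{2..k}. t j \<ge> 1\<close> False show ?thesis by force
    qed (use assms(4) k in simp)
    ultimately show ?thesis
      using assms(3,4) block_list_map_upt[of 1 k p ?m] by simp
  qed
  have "?bs = ?R s t \<longleftrightarrow> m 1 = p 1 + 2 * s \<and> (\<forall>j\<in>{2..k}. m j = 2 * t j)" for s t
    unfolding upt by (auto simp del: upt_Suc)
  \<comment> \<open>The right-hand list is known to be a block list only when every
    \<open>t j\<close> is positive; \<open>conj_cong\<close> supplies that assumption to the
    injectivity rule.\<close>
  then have "(\<exists>s t. (\<forall>j\<in>{2..k}. t j \<ge> 1) \<and> \<sigma> = of_blocks (?R s t)) \<longleftrightarrow>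
      (\<exists>s t. (\<forall>j\<in>{2..k}. t j \<ge> 1) \<and> m 1 = p 1 + 2 * s \<and> (\<forall>j\<in>{2..k}. m j = 2 * t j))"
    using of_blocks_eq_iff[OF bs R] assms(6) by (simp cong: conj_cong)
  also have "\<dots> \<longleftrightarrow> (\<exists>s. m 1 = p 1 + 2 * s) \<and> (\<forall>j\<in>{2..k}. even (m j))" (is "?A \<longleftrightarrow> ?B")
  proof
    assume ?B
    then obtain s where "m 1 = p 1 + 2 * s" "\<forall>j\<in>{2..k}. even (m j)" by auto
    \<comment> \<open>The witness for \<open>t j\<close> is half of \<open>m j\<close>, at least 1
      because \<open>m j\<close> is even and positive.\<close>
    moreover have "m j div 2 \<ge> 1" if "j \<in> {2..k}" "even (m j)" for j
    proof -
      have "m j \<ge> 1" using that assms(5) by simp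
      with that(2) show ?thesis by presburger
    qed
    ultimately show ?A
      by (intro exI[of _ s] exI[of _ "\<lambda>j. m j div 2"]) simp
  qed auto
  also have "\<dots> \<longleftrightarrow> delta_blocks ?bs = 0 \<and> delta_star_blocks ?bs = 0"
    using delta_and_delta_star_blocks_eq_0_iff[OF bs _ k] part mult k
    by (simp del: upt_Suc)
  finally show ?thesis
    using assms(6) to_blocks_of_blocks[OF bs] by (simp add: delta_basis delta_star_basis del: upt_Suc)
qed

end
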